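(* Let $Q$ be an acyclic quiver, let $v\in Q_0$ be a sink, and let $\mathbf{d}\in\mathbb{Z}_{\geq 0}^{Q_0}$ with $d_v=d$. Let $\{\mathcal{A},\mathcal{B}\}$ be a partition of the set $\{\alpha\in Q_1 \mid t(\alpha)=v\}$ of arrows with terminal vertex $v$. Define a quiver $\overline{Q}=(\overline{Q}_0,\overline{Q}_1)$ by splitting $v$ into two new distinct vertices $v^{\mathcal{A}},v^{\mathcal{B}}$: $\overline{Q}_0:=(Q_0\setminus\{v\})\cup\{v^{\mathcal{A}},v^{\mathcal{B}}\}$, $\overline{\mathcal{A}}:=\{\overline{\alpha}: s(\alpha)\to v^{\mathcal{A}} \mid \alpha\in\mathcal{A}\}$, $\overline{\mathcal{B}}:=\{\overline{\beta}: s(\beta)\to v^{\mathcal{B}} \mid \beta\in\mathcal{B}\}$, and $\overline{Q}_1:=(Q_1\setminus(\mathcal{A}\cup\mathcal{B}))\cup\overline{\mathcal{A}}\cup\overline{\mathcal{B}}$. Define $\overline{\mathbf{d}}\in\mathbb{Z}_{\geq 0}^{\overline{Q}_0}$ by $\overline{d}_{v^{\mathcal{A}}}=\overline{d}_{v^{\mathcal{B}}}=d$ and $\overline{d}_i=d_i$ for all $i\in Q_0\setminus\{v\}$. Then $\operatorname{rad}A_{Q,\mathbf{d}}\cong\operatorname{rad}A_{\overline{Q},\overline{\mathbf{d}}}$ (as ideals, in the sense defined in the context). In particular, $[Q,\mathbf{d}]=[\overline{Q},\overline{\mathbf{d}}]$.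
   Context: Let $\mathbb{k}=\mathbb{F}_q$ be a finite field. A quiver $Q=(Q_0,Q_1)$ consists of a finite set $Q_0$ of vertices and a finite set $Q_1$ of arrows, each arrow $\alpha$ having a source $s(\alpha)$ and a target $t(\alpha)$ in $Q_0$; multiple arrows are allowed. $Q$ is acyclic if it has no oriented cycles. A source is a vertex that is the target of no arrow; a sink is a vertex that is the source of no arrow. Paths are written left to right ($cp$ means first $c$, then $p$). For a vertex $i$, $P_Q(i)$ is the indecomposable projective representation of $Q$ over $\mathbb{k}$ at $i$: its space at vertex $j$ has as basis the set of all paths from $i$ to $j$ (including the constant path $e_i$ if $j=i$), and an arrow $\alpha:j\to k$ acts by $c\mapsto c\alpha$. For a summand vector $\mathbf{d}\in\mathbb{Z}_{\geq 0}^{Q_0}$, $P_{Q,\mathbf{d}}:=\bigoplus_{i\in Q_0}P_Q(i)^{d_i}$ and $A_{Q,\mathbf{d}}:=\operatorname{End}(P_{Q,\mathbf{d}})$ is its endomorphism algebra in the category of representations of $Q$ over $\mathbb{k}$. $\operatorname{rad}$ denotes the Jacobson radical. The count $[Q,\mathbf{d}]$ is the number of pairs $(x,y)\in\operatorname{rad}A_{Q,\mathbf{d}}\times\operatorname{rad}A_{Q,\mathbf{d}}$ with $xy=yx$. Two-sided ideals $I\unlhd A$, $J\unlhd B$ of $\mathbb{k}$-algebras are called isomorphic, $I\cong J$, if there is a bijective $\mathbb{k}$-linear map $\Psi:I\to J$ with $\Psi(i_1 i_2)=\Psi(i_1)\Psi(i_2)$ for all $i_1,i_2\in I$. *)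

theory Defs
  imports
    "HOL-Algebra.Module"
    "HOL-Algebra.Ideal"
    "HOL-Library.FuncSet"
    "Graph_Theory.Digraph"
    "Graph_Theory.Arc_Walk"
begin

text \<open>
  A quiver is a \<open>fin_digraph\<close> (finitely many vertices and arcs, with multiple arcs and loops
  permitted by the locale); \<open>tail\<close> is the source map and \<open>head\<close> the target map. Paths are the
  arc walks \<open>pre_digraph.awalk\<close>: lists of arcs read from left to right, the constant path at
  any vertex being the empty list.
\<close>

section \<open>Quiver representations\<close>

text \<open>
  The vector spaces of a representation over the field \<open>'k\<close> are subspaces of the space
  \<open>'b \<Rightarrow> 'k\<close> with its pointwise operations. The map of an arc \<open>\<alpha>\<close> is only meaningful on the
  space at \<open>tail Q \<alpha>\<close>.
\<close>

record ('v, 'e, 'b, 'k) quiver_rep =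
  rep_space :: "'v \<Rightarrow> ('b \<Rightarrow> 'k) set"
  rep_map :: "'e \<Rightarrow> ('b \<Rightarrow> 'k) \<Rightarrow> ('b \<Rightarrow> 'k)"

definition linear_on :: "('b \<Rightarrow> 'k::field) set \<Rightarrow> (('b \<Rightarrow> 'k) \<Rightarrow> ('c \<Rightarrow> 'k)) \<Rightarrow> bool" where
  "linear_on S f \<longleftrightarrow>
     (\<forall>x\<in>S. \<forall>y\<in>S. f (\<lambda>b. x b + y b) = (\<lambda>b. f x b + f y b)) \<and>
     (\<forall>c. \<forall>x\<in>S. f (\<lambda>b. c * x b) = (\<lambda>b. c * f x b))"

text \<open>
  The projective representation at \<open>i\<close>. A vector at \<open>j\<close> is a formal linear combination of paths
  from \<open>i\<close> to \<open>j\<close>, given by its coefficient function; the map of \<open>\<alpha>\<close> is the linear extension of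
  \<open>c \<mapsto> c @ [\<alpha>]\<close>, whose value has at \<open>p\<close> the coefficient written below.
\<close>

definition proj_rep ::
  "('v, 'e) pre_digraph \<Rightarrow> 'v \<Rightarrow> ('v, 'e, 'e list, 'k::field) quiver_rep" where
  "proj_rep Q i =
     \<lparr> rep_space = (\<lambda>j. {x. finite {c. x c \<noteq> 0} \<and> (\<forall>c. x c \<noteq> 0 \<longrightarrow> pre_digraph.awalk Q i c j)}),
       rep_map = (\<lambda>\<alpha> x p. \<Sum>c | x c \<noteq> 0. if c @ [\<alpha>] = p then x c else 0) \<rparr>"

text \<open>
  Direct sum over a finite index set \<open>S\<close>; the component of \<open>x\<close> in the summand \<open>s\<close> is
  \<open>\<lambda>b. x (s, b)\<close>.
\<close>

definition rep_sum ::
  "'s set \<Rightarrow> ('s \<Rightarrow> ('v, 'e, 'b, 'k::field) quiver_rep) \<Rightarrow> ('v, 'e, 's \<times> 'b, 'k) quiver_rep" where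
  "rep_sum S M =
     \<lparr> rep_space = (\<lambda>j. {x. (\<forall>s\<in>S. (\<lambda>b. x (s, b)) \<in> rep_space (M s) j) \<and>
                            (\<forall>s b. s \<notin> S \<longrightarrow> x (s, b) = 0)}),
       rep_map = (\<lambda>\<alpha> x (s, b). if s \<in> S then rep_map (M s) \<alpha> (\<lambda>b'. x (s, b')) b else 0) \<rparr>"

text \<open>The summand with index \<open>(i, n)\<close> is the \<open>n\<close>-th of the \<open>d i\<close> copies of the projective at \<open>i\<close>.\<close>

definition proj_sum ::
  "('v, 'e) pre_digraph \<Rightarrow> ('v \<Rightarrow> nat)
    \<Rightarrow> ('v, 'e, ('v \<times> nat) \<times> 'e list, 'k::field) quiver_rep" where
  "proj_sum Q d = rep_sum {(i, n). i \<in> verts Q \<and> n < d i} (\<lambda>(i, n). proj_rep Q i)"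

text \<open>
  Endomorphisms are families of linear maps indexed by the vertices. They are required to be
  \<open>undefined\<close> outside the vertices and outside the respective spaces, so that equality of
  families is equality of endomorphisms.
\<close>

definition rep_endos ::
  "('v, 'e) pre_digraph \<Rightarrow> ('v, 'e, 'b, 'k::field) quiver_rep
    \<Rightarrow> ('v \<Rightarrow> ('b \<Rightarrow> 'k) \<Rightarrow> ('b \<Rightarrow> 'k)) set" where
  "rep_endos Q M =
     {f \<in> (\<Pi>\<^sub>E j\<in>verts Q. {g \<in> rep_space M j \<rightarrow>\<^sub>E rep_space M j. linear_on (rep_space M j) g}).
        \<forall>\<alpha>\<in>arcs Q. \<forall>x\<in>rep_space M (tail Q \<alpha>).
          f (head Q \<alpha>) (rep_map M \<alpha> x) = rep_map M \<alpha> (f (tail Q \<alpha>) x)}"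

text \<open>
  The record \<open>module\<close> of HOL-Algebra comprises the ring operations and the scalar
  multiplication, hence serves as the record of (not necessarily commutative) algebras.
\<close>

definition End_algebra ::
  "('v, 'e) pre_digraph \<Rightarrow> ('v, 'e, 'b, 'k::field) quiver_rep
    \<Rightarrow> ('k, 'v \<Rightarrow> ('b \<Rightarrow> 'k) \<Rightarrow> ('b \<Rightarrow> 'k)) module" where
  "End_algebra Q M =
     \<lparr> carrier = rep_endos Q M,
       mult = (\<lambda>f g. \<lambda>j\<in>verts Q. \<lambda>x\<in>rep_space M j. f j (g j x)),
       one = (\<lambda>j\<in>verts Q. \<lambda>x\<in>rep_space M j. x),
       zero = (\<lambda>j\<in>verts Q. \<lambda>x\<in>rep_space M j. \<lambda>b. 0),
       add = (\<lambda>f g. \<lambda>j\<in>verts Q. \<lambda>x\<in>rep_space M j. \<lambda>b. f j x b + g j x b),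
       smult = (\<lambda>c f. \<lambda>j\<in>verts Q. \<lambda>x\<in>rep_space M j. \<lambda>b. c * f j x b) \<rparr>"

abbreviation A_algebra ::
  "('v, 'e) pre_digraph \<Rightarrow> ('v \<Rightarrow> nat)
    \<Rightarrow> ('k::field, 'v \<Rightarrow> (('v \<times> nat) \<times> 'e list \<Rightarrow> 'k) \<Rightarrow> (('v \<times> nat) \<times> 'e list \<Rightarrow> 'k)) module" where
  "A_algebra Q d \<equiv> End_algebra Q (proj_sum Q d)"


section \<open>Jacobson radical and isomorphism of ideals\<close>

definition left_ideal :: "'a set \<Rightarrow> ('a, 'm) ring_scheme \<Rightarrow> bool" where
  "left_ideal I R \<longleftrightarrow> additive_subgroup I R \<and> (\<forall>r\<in>carrier R. \<forall>x\<in>I. r \<otimes>\<^bsub>R\<^esub> x \<in> I)"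

definition maximal_left_ideal :: "'a set \<Rightarrow> ('a, 'm) ring_scheme \<Rightarrow> bool" where
  "maximal_left_ideal I R \<longleftrightarrow> left_ideal I R \<and> I \<noteq> carrier R \<and>
     (\<forall>J. left_ideal J R \<and> I \<subseteq> J \<longrightarrow> J = I \<or> J = carrier R)"

text \<open>Intersecting with the carrier matters only for the zero ring, which is its own radical.\<close>

definition jacobson_radical :: "('a, 'm) ring_scheme \<Rightarrow> 'a set" where
  "jacobson_radical R = carrier R \<inter> \<Inter> {I. maximal_left_ideal I R}"

definition ideals_isomorphic ::
  "('k, 'a) module \<Rightarrow> 'a set \<Rightarrow> ('k, 'b) module \<Rightarrow> 'b set \<Rightarrow> bool" where
  "ideals_isomorphic A I B J \<longleftrightarrow> ideal I A \<and> ideal J B \<and>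
     (\<exists>\<Psi>. bij_betw \<Psi> I J \<and>
        (\<forall>x\<in>I. \<forall>y\<in>I. \<Psi> (x \<oplus>\<^bsub>A\<^esub> y) = \<Psi> x \<oplus>\<^bsub>B\<^esub> \<Psi> y) \<and>
        (\<forall>c. \<forall>x\<in>I. \<Psi> (c \<odot>\<^bsub>A\<^esub> x) = c \<odot>\<^bsub>B\<^esub> \<Psi> x) \<and>
        (\<forall>x\<in>I. \<forall>y\<in>I. \<Psi> (x \<otimes>\<^bsub>A\<^esub> y) = \<Psi> x \<otimes>\<^bsub>B\<^esub> \<Psi> y))"

text \<open>The type argument supplies the ground field, on which the count depends.\<close>

definition commuting_count ::
  "'k::field itself \<Rightarrow> ('v, 'e) pre_digraph \<Rightarrow> ('v \<Rightarrow> nat) \<Rightarrow> nat" where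
  "commuting_count _ Q d =
     (let A = (A_algebra Q d :: ('k, _) module); R = jacobson_radical A
      in card {(x, y). x \<in> R \<and> y \<in> R \<and> x \<otimes>\<^bsub>A\<^esub> y = y \<otimes>\<^bsub>A\<^esub> x})"


section \<open>Splitting a sink\<close>

datatype 'v split_vertex = Old 'v | SplitA | SplitB

text \<open>
  An arrow \<open>\<alpha>\<close> in \<open>\<A> \<union> \<B>\<close> and the arrow that replaces it carry the same label and differ in
  their targets. The sources are never \<open>v\<close>, as \<open>v\<close> is a sink.
\<close>

definition split_quiver ::
  "('v, 'e) pre_digraph \<Rightarrow> 'v \<Rightarrow> 'e set \<Rightarrow> 'e set \<Rightarrow> ('v split_vertex, 'e) pre_digraph" where
  "split_quiver Q v \<A> \<B> =
     \<lparr> verts = Old ` (verts Q - {v}) \<union> {SplitA, SplitB},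
       arcs = (arcs Q - (\<A> \<union> \<B>)) \<union> \<A> \<union> \<B>,
       tail = (\<lambda>\<alpha>. Old (tail Q \<alpha>)),
       head = (\<lambda>\<alpha>. if \<alpha> \<in> \<A> then SplitA else if \<alpha> \<in> \<B> then SplitB else Old (head Q \<alpha>)) \<rparr>"

fun split_dim :: "('v \<Rightarrow> nat) \<Rightarrow> 'v \<Rightarrow> 'v split_vertex \<Rightarrow> nat" where
  "split_dim d v (Old i) = d i"
| "split_dim d v SplitA = d v"
| "split_dim d v SplitB = d v"

end

theory Submission
  imports Defs
begin

text \<open>
  A homomorphism \<open>P(i) \<rightarrow> P(j)\<close> is determined by the image of the generator, a linear
  combination of paths from \<open>j\<close> to \<open>i\<close>. So an endomorphism of the sum is a matrix of linear
  combinations of paths, and composition multiplies matrices by concatenating paths. The radical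
  consists of the matrices without constant paths: these form an ideal, which is nilpotent since
  path lengths are bounded in an acyclic quiver, and modulo it the algebra is a product of matrix
  algebras. Splitting the sink permits a bijection of the nonconstant paths, as each of them
  ends with an arrow that tells the half of the sink it reaches. Two nonconstant paths are never
  concatenated at a sink, so this bijection is compatible with composition.
\<close>

section \<open>Left ideals and the radical\<close>

text \<open>Negatives come for free, as \<open>\<ominus> x\<close> is the left multiple of
  \<open>x\<close> by \<open>\<ominus> \<one>\<close>; so no closure under inverses has to be
  checked.\<close>

lemma (in ring) left_idealI:
  assumes "I \<subseteq> carrier R" "\<zero> \<in> I"
    and "\<And>x y. x \<in> I \<Longrightarrow> y \<in> I \<Longrightarrow> x \<oplus> y \<in> I"
    and "\<And>r x. r \<in> carrier R \<Longrightarrow> x \<in> I \<Longrightarrow> r \<otimes> x \<in> I"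
  shows "left_ideal I R"
proof -
  have neg: "\<ominus> x \<in> I" if "x \<in> I" for x
  proof -
    have "\<ominus> x = (\<ominus> \<one>) \<otimes> x"
      using assms(1) that l_minus by auto
    then show ?thesis using assms(4)[of "\<ominus> \<one>" x] that by simp
  qed
  have "subgroup I (add_monoid R)"
    by (rule add.subgroupI) (use assms neg in \<open>auto simp: a_inv_def[symmetric]\<close>)
  then show ?thesis
    unfolding left_ideal_def using assms(4) by (auto intro: additive_subgroupI)
qed

lemma (in ring) left_idealD:
  assumes "left_ideal I R"
  shows "I \<subseteq> carrier R" "\<zero> \<in> I"
    and "\<And>x y. x \<in> I \<Longrightarrow> y \<in> I \<Longrightarrow> x \<oplus> y \<in> I"
    and "\<And>r x. r \<in> carrier R \<Longrightarrow> x \<in> I \<Longrightarrow> r \<otimes> x \<in> I"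
    and "\<one> \<in> I \<Longrightarrow> I = carrier R"
proof -
  interpret additive_subgroup I R using assms by (simp add: left_ideal_def)
  show 1: "I \<subseteq> carrier R" "\<zero> \<in> I" "\<And>x y. x \<in> I \<Longrightarrow> y \<in> I \<Longrightarrow> x \<oplus> y \<in> I"
    using a_subset by auto
  show 2: "\<And>r x. r \<in> carrier R \<Longrightarrow> x \<in> I \<Longrightarrow> r \<otimes> x \<in> I"
    using assms by (simp add: left_ideal_def)
  show "I = carrier R" if "\<one> \<in> I"
    using 1(1) 2[OF _ that] by (metis r_one subsetI subset_antisym)
qed

text \<open>If a maximal left ideal \<open>I\<close> did not contain \<open>N\<close>, then
  \<open>I + N\<close> would be the whole ring and \<open>\<one> = i \<oplus> n\<close>. This makes
  \<open>\<one>\<close> congruent modulo \<open>I\<close> to all powers of \<open>n\<close>, one of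
  which is zero.\<close>

lemma (in ring) nil_left_ideal_subset_jacobson_radical:
  assumes N: "left_ideal N R" and nil: "\<And>x. x \<in> N \<Longrightarrow> \<exists>k::nat. x [^] k = \<zero>"
  shows "N \<subseteq> jacobson_radical R"
proof -
  note ND = left_idealD[OF N]
  have "N \<subseteq> I" if max: "maximal_left_ideal I R" for I
  proof (rule ccontr)
    assume nsub: "\<not> N \<subseteq> I"
    have I: "left_ideal I R" and proper: "I \<noteq> carrier R"
      and maxI: "\<And>J. left_ideal J R \<Longrightarrow> I \<subseteq> J \<Longrightarrow> J = I \<or> J = carrier R"
      using max by (auto simp: maximal_left_ideal_def)
    note ID = left_idealD[OF I]
    \<comment> \<open>The sum of the two left ideals. It contains \<open>I\<close> properly, so
      maximality makes it the whole ring.\<close>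
    define J where "J = {i \<oplus> n | i n. i \<in> I \<and> n \<in> N}"
    have J: "left_ideal J R"
    proof (rule left_idealI)
      show "J \<subseteq> carrier R" using ID(1) ND(1) by (auto simp: J_def)
      show "\<zero> \<in> J" unfolding J_def using ID(2) ND(2) by force
      show "x \<oplus> y \<in> J" if "x \<in> J" "y \<in> J" for x y
      proof -
        from that obtain i n i' n' where *: "x = i \<oplus> n" "y = i' \<oplus> n'"
          "i \<in> I" "n \<in> N" "i' \<in> I" "n' \<in> N" by (auto simp: J_def)
        then have "x \<oplus> y = (i \<oplus> i') \<oplus> (n \<oplus> n')"
          using ID(1) ND(1) by (simp add: subset_iff a_ac)
        then show ?thesis using * ID(3) ND(3) unfolding J_def by blast
      qed
      show "r \<otimes> x \<in> J" if "r \<in> carrier R" "x \<in> J" for r x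
      proof -
        from that obtain i n where *: "x = i \<oplus> n" "i \<in> I" "n \<in> N" by (auto simp: J_def)
        then have "r \<otimes> x = r \<otimes> i \<oplus> r \<otimes> n"
          using ID(1) ND(1) that by (simp add: subset_iff r_distr)
        then show ?thesis using * ID(4) ND(4) that unfolding J_def by blast
      qed
    qed
    have "I \<subseteq> J"
    proof
      fix i assume "i \<in> I"
      then have "i = i \<oplus> \<zero>" using ID(1) by auto
      then show "i \<in> J" using \<open>i \<in> I\<close> ND(2) by (auto simp: J_def)
    qed
    moreover have "N \<subseteq> J"
    proof
      fix n assume "n \<in> N"
      then have "n = \<zero> \<oplus> n" using ND(1) by auto
      then show "n \<in> J" using \<open>n \<in> N\<close> ID(2) by (auto simp: J_def)
    qed
    ultimately have "J = carrier R" using maxI[OF J] nsub by auto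
    then obtain i n where in': "\<one> = i \<oplus> n" "i \<in> I" "n \<in> N"
      using one_closed unfolding J_def by blast
    then have c: "i \<in> carrier R" "n \<in> carrier R" using ID(1) ND(1) by auto
    \<comment> \<open>Multiplying \<open>\<one> = i \<oplus> n\<close> from the left by
      \<open>n [^] k\<close> replaces \<open>n [^] k\<close> by \<open>n [^] Suc k\<close> at the
      cost of \<open>n [^] k \<otimes> i\<close>, which stays in the left ideal
      \<open>I\<close>.\<close>
    have powI: "\<exists>j\<in>I. \<one> = j \<oplus> n [^] k" for k :: nat
    proof (induction k)
      case 0
      then show ?case using ID(2) by (intro bexI[of _ \<zero>]) auto
    next
      case (Suc k)
      then obtain j where j: "j \<in> I" "\<one> = j \<oplus> n [^] k" by auto
      have jc: "j \<in> carrier R" using j ID(1) by auto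
      have "n [^] k = n [^] k \<otimes> (i \<oplus> n)" using c in'(1)[symmetric] by simp
      with j(2) have "\<one> = j \<oplus> n [^] k \<otimes> (i \<oplus> n)" by simp
      also have "\<dots> = (j \<oplus> n [^] k \<otimes> i) \<oplus> n [^] Suc k"
        using c jc by (simp add: r_distr a_assoc)
      finally show ?case using ID(3)[OF j(1) ID(4)[OF _ in'(2)], of "n [^] k"] c by auto
    qed
    obtain k :: nat where "n [^] k = \<zero>" using nil[OF in'(3)] by auto
    then have "\<one> \<in> I" using powI[of k] ID(1) by auto
    then show False using ID(5) proper by auto
  qed
  then show ?thesis unfolding jacobson_radical_def using ND(1) by auto
qed

text \<open>Products of elements of \<open>I\<close> stay in \<open>I\<close>, where
  \<open>\<Psi>\<close> is injective and multiplicative; so applying \<open>\<Psi>\<close> to both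
  coordinates preserves and reflects commutation.\<close>

lemma ideals_isomorphic_commuting_pairs:
  assumes "ideals_isomorphic A I B J"
  shows "card {(x, y). x \<in> I \<and> y \<in> I \<and> x \<otimes>\<^bsub>A\<^esub> y = y \<otimes>\<^bsub>A\<^esub> x} =
         card {(x, y). x \<in> J \<and> y \<in> J \<and> x \<otimes>\<^bsub>B\<^esub> y = y \<otimes>\<^bsub>B\<^esub> x}"
proof -
  obtain \<Psi> where bij: "bij_betw \<Psi> I J" and I: "ideal I A"
    and mult: "\<And>x y. x \<in> I \<Longrightarrow> y \<in> I \<Longrightarrow> \<Psi> (x \<otimes>\<^bsub>A\<^esub> y) = \<Psi> x \<otimes>\<^bsub>B\<^esub> \<Psi> y"
    using assms unfolding ideals_isomorphic_def by auto
  have closed: "x \<otimes>\<^bsub>A\<^esub> y \<in> I" if "x \<in> I" "y \<in> I" for x y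
    using ideal.I_l_closed[OF I that(2)] ideal.Icarr[OF I that(1)] by simp
  have comm: "\<Psi> x \<otimes>\<^bsub>B\<^esub> \<Psi> y = \<Psi> y \<otimes>\<^bsub>B\<^esub> \<Psi> x \<longleftrightarrow> x \<otimes>\<^bsub>A\<^esub> y = y \<otimes>\<^bsub>A\<^esub> x"
    if "x \<in> I" "y \<in> I" for x y
    using inj_on_eq_iff[OF bij_betw_imp_inj_on[OF bij] closed[OF that] closed[OF that(2,1)]]
    by (simp add: mult that)
  have "bij_betw (map_prod \<Psi> \<Psi>) {(x, y). x \<in> I \<and> y \<in> I \<and> x \<otimes>\<^bsub>A\<^esub> y = y \<otimes>\<^bsub>A\<^esub> x}
      {(x, y). x \<in> J \<and> y \<in> J \<and> x \<otimes>\<^bsub>B\<^esub> y = y \<otimes>\<^bsub>B\<^esub> x}"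
  proof (rule bij_betw_imageI)
    show "inj_on (map_prod \<Psi> \<Psi>) {(x, y). x \<in> I \<and> y \<in> I \<and> x \<otimes>\<^bsub>A\<^esub> y = y \<otimes>\<^bsub>A\<^esub> x}"
      using bij_betw_imp_inj_on[OF bij] by (auto simp: inj_on_def)
    show "map_prod \<Psi> \<Psi> ` {(x, y). x \<in> I \<and> y \<in> I \<and> x \<otimes>\<^bsub>A\<^esub> y = y \<otimes>\<^bsub>A\<^esub> x} =
        {(x, y). x \<in> J \<and> y \<in> J \<and> x \<otimes>\<^bsub>B\<^esub> y = y \<otimes>\<^bsub>B\<^esub> x}"
      using comm bij_betw_imp_surj_on[OF bij] by (auto simp: image_iff)
  qed
  then show ?thesis by (rule bij_betw_same_card)
qed

section \<open>The endomorphism algebra of a representation\<close>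

text \<open>The record type imposes no laws; these are the ones that make it a representation by
  subspaces and linear maps.\<close>

locale quiver_representation = wf_digraph Q
  for Q :: "('v, 'e) pre_digraph" and M :: "('v, 'e, 'b, 'k::field) quiver_rep" +
  assumes space_zero: "j \<in> verts Q \<Longrightarrow> (\<lambda>b. 0) \<in> rep_space M j"
    and space_add: "j \<in> verts Q \<Longrightarrow> x \<in> rep_space M j \<Longrightarrow> y \<in> rep_space M j
      \<Longrightarrow> (\<lambda>b. x b + y b) \<in> rep_space M j"
    and space_scale: "j \<in> verts Q \<Longrightarrow> x \<in> rep_space M j \<Longrightarrow> (\<lambda>b. c * x b) \<in> rep_space M j"
    and map_space: "\<alpha> \<in> arcs Q \<Longrightarrow> x \<in> rep_space M (tail Q \<alpha>)
      \<Longrightarrow> rep_map M \<alpha> x \<in> rep_space M (head Q \<alpha>)"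
    and map_linear: "\<alpha> \<in> arcs Q \<Longrightarrow> linear_on (rep_space M (tail Q \<alpha>)) (rep_map M \<alpha>)"
begin

lemma rep_endosD:
  assumes "f \<in> rep_endos Q M"
  shows "j \<in> verts Q \<Longrightarrow> x \<in> rep_space M j \<Longrightarrow> f j x \<in> rep_space M j"
    and "j \<in> verts Q \<Longrightarrow> x \<in> rep_space M j \<Longrightarrow> y \<in> rep_space M j
      \<Longrightarrow> f j (\<lambda>b. x b + y b) = (\<lambda>b. f j x b + f j y b)"
    and "j \<in> verts Q \<Longrightarrow> x \<in> rep_space M j \<Longrightarrow> f j (\<lambda>b. c * x b) = (\<lambda>b. c * f j x b)"
    and "\<alpha> \<in> arcs Q \<Longrightarrow> x \<in> rep_space M (tail Q \<alpha>)
      \<Longrightarrow> f (head Q \<alpha>) (rep_map M \<alpha> x) = rep_map M \<alpha> (f (tail Q \<alpha>) x)"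
  using assms by (auto simp: rep_endos_def linear_on_def PiE_iff)

lemma rep_endos_eqI:
  assumes "f \<in> rep_endos Q M" "g \<in> rep_endos Q M"
    and "\<And>j x. j \<in> verts Q \<Longrightarrow> x \<in> rep_space M j \<Longrightarrow> f j x = g j x"
  shows "f = g"
proof (rule PiE_ext)
  show "f \<in> (\<Pi>\<^sub>E j\<in>verts Q. rep_space M j \<rightarrow>\<^sub>E rep_space M j)"
    and "g \<in> (\<Pi>\<^sub>E j\<in>verts Q. rep_space M j \<rightarrow>\<^sub>E rep_space M j)"
    using assms(1,2) by (auto simp: rep_endos_def PiE_iff)
  show "f j = g j" if "j \<in> verts Q" for j
    by (rule PiE_ext[of _ "rep_space M j" "\<lambda>_. rep_space M j"])
      (use assms that in \<open>auto simp: rep_endos_def PiE_iff\<close>)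
qed

lemma rep_endosI:
  assumes "\<And>j x. j \<in> verts Q \<Longrightarrow> x \<in> rep_space M j \<Longrightarrow> h j x \<in> rep_space M j"
    and "\<And>j x y. j \<in> verts Q \<Longrightarrow> x \<in> rep_space M j \<Longrightarrow> y \<in> rep_space M j
      \<Longrightarrow> h j (\<lambda>b. x b + y b) = (\<lambda>b. h j x b + h j y b)"
    and "\<And>j x c. j \<in> verts Q \<Longrightarrow> x \<in> rep_space M j \<Longrightarrow> h j (\<lambda>b. c * x b) = (\<lambda>b. c * h j x b)"
    and "\<And>\<alpha> x. \<alpha> \<in> arcs Q \<Longrightarrow> x \<in> rep_space M (tail Q \<alpha>)
      \<Longrightarrow> h (head Q \<alpha>) (rep_map M \<alpha> x) = rep_map M \<alpha> (h (tail Q \<alpha>) x)"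
  shows "(\<lambda>j\<in>verts Q. \<lambda>x\<in>rep_space M j. h j x) \<in> rep_endos Q M"
  using assms by (auto simp: rep_endos_def linear_on_def space_add space_scale map_space)

lemma map_add:
  assumes "\<alpha> \<in> arcs Q" "x \<in> rep_space M (tail Q \<alpha>)" "y \<in> rep_space M (tail Q \<alpha>)"
  shows "rep_map M \<alpha> (\<lambda>b. x b + y b) = (\<lambda>b. rep_map M \<alpha> x b + rep_map M \<alpha> y b)"
  using map_linear[OF assms(1)] assms by (simp add: linear_on_def)

lemma map_scale:
  assumes "\<alpha> \<in> arcs Q" "x \<in> rep_space M (tail Q \<alpha>)"
  shows "rep_map M \<alpha> (\<lambda>b. c * x b) = (\<lambda>b. c * rep_map M \<alpha> x b)"
  using map_linear[OF assms(1)] assms by (simp add: linear_on_def)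

lemma map_zero: "\<alpha> \<in> arcs Q \<Longrightarrow> rep_map M \<alpha> (\<lambda>b. 0) = (\<lambda>b. 0)"
  using map_scale[of \<alpha> "\<lambda>b. 0" 0] space_zero by simp

abbreviation "E \<equiv> End_algebra Q M"

lemma End_closed:
  assumes "f \<in> carrier E" "g \<in> carrier E"
  shows "f \<otimes>\<^bsub>E\<^esub> g \<in> carrier E" "f \<oplus>\<^bsub>E\<^esub> g \<in> carrier E" "c \<odot>\<^bsub>E\<^esub> f \<in> carrier E"
proof -
  have f: "f \<in> rep_endos Q M" and g: "g \<in> rep_endos Q M"
    using assms by (auto simp: End_algebra_def)
  note D = rep_endosD[OF f] rep_endosD[OF g]
  show "f \<otimes>\<^bsub>E\<^esub> g \<in> carrier E"
    unfolding End_algebra_def by (simp, rule rep_endosI) (simp_all add: D)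
  show "f \<oplus>\<^bsub>E\<^esub> g \<in> carrier E"
    unfolding End_algebra_def
    by (simp, rule rep_endosI) (simp_all add: D space_add map_add algebra_simps)
  show "c \<odot>\<^bsub>E\<^esub> f \<in> carrier E"
    unfolding End_algebra_def
    by (simp, rule rep_endosI) (simp_all add: D space_scale map_scale algebra_simps)
qed

lemma End_one_zero: "\<one>\<^bsub>E\<^esub> \<in> carrier E" "\<zero>\<^bsub>E\<^esub> \<in> carrier E"
  unfolding End_algebra_def
  by (simp_all, (rule rep_endosI; simp add: space_zero map_zero)+)

lemma End_apply:
  assumes "j \<in> verts Q" "x \<in> rep_space M j"
  shows "(f \<otimes>\<^bsub>E\<^esub> g) j x = f j (g j x)"
    and "(f \<oplus>\<^bsub>E\<^esub> g) j x = (\<lambda>b. f j x b + g j x b)"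
    and "(c \<odot>\<^bsub>E\<^esub> f) j x = (\<lambda>b. c * f j x b)"
    and "\<one>\<^bsub>E\<^esub> j x = x" and "\<zero>\<^bsub>E\<^esub> j x = (\<lambda>b. 0)"
  using assms by (simp_all add: End_algebra_def)

lemma End_eqI:
  assumes "f \<in> carrier E" "g \<in> carrier E"
    and "\<And>j x. j \<in> verts Q \<Longrightarrow> x \<in> rep_space M j \<Longrightarrow> f j x = g j x"
  shows "f = g"
  using assms by (intro rep_endos_eqI) (auto simp: End_algebra_def)

lemma End_endo: "f \<in> carrier E \<Longrightarrow> f \<in> rep_endos Q M"
  by (simp add: End_algebra_def)

lemma End_ring: "ring E"
proof (rule ringI)
  note D = rep_endosD[OF End_endo]
  show "abelian_group E"
  proof (rule abelian_groupI)
    fix f assume f: "f \<in> carrier E"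
    \<comment> \<open>The additive inverse is the scalar multiple by -1.
      \<open>End_closed(3)\<close> inherits two carrier premises, both met by
      \<open>f\<close>.\<close>
    have "((- 1) \<odot>\<^bsub>E\<^esub> f) \<oplus>\<^bsub>E\<^esub> f = \<zero>\<^bsub>E\<^esub>"
      by (rule End_eqI) (simp_all add: End_closed End_closed(3)[OF f f] End_one_zero f End_apply)
    then show "\<exists>g\<in>carrier E. g \<oplus>\<^bsub>E\<^esub> f = \<zero>\<^bsub>E\<^esub>"
      using End_closed(3)[OF f f] by blast
  qed (auto intro!: End_eqI simp: End_closed End_one_zero End_apply algebra_simps)
  show "monoid E"
    by (rule monoidI; (rule End_eqI)?) (simp_all add: End_closed End_one_zero End_apply D)
qed (rule End_eqI; simp add: End_closed End_apply rep_endosD[OF End_endo])+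

end

text \<open>A walk that repeats a vertex contains a nonempty closed walk and hence a cycle. So all
  walks visit distinct vertices, which bounds their length by the number of vertices.\<close>

lemma (in fin_digraph) finite_walks_if_acyclic:
  assumes "\<nexists>p. cycle p"
  shows "finite {p. \<exists>i j. awalk i p j}"
proof (rule finite_subset)
  show "{p. \<exists>i j. awalk i p j} \<subseteq> {p. set p \<subseteq> arcs G \<and> length p \<le> card (verts G)}"
  proof clarify
    fix p i j assume w: "awalk i p j"
    have "distinct (awalk_verts i p)"
    proof (rule ccontr)
      assume "\<not> distinct (awalk_verts i p)"
      from awalk_not_distinct_decomp[OF w this] obtain r w where "awalk w r w" "0 < length r"
        by blast
      then show False using closed_w_imp_cycle[of r] assms by (auto simp: closed_w_def)
    qed
    then have "Suc (length p) = card (set (awalk_verts i p))"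
      by (simp add: distinct_card length_awalk_verts)
    also have "\<dots> \<le> card (verts G)"
      using w by (intro card_mono) auto
    finally show "set p \<subseteq> arcs G \<and> length p \<le> card (verts G)"
      using w by (auto simp: awalk_def)
  qed
  show "finite {p. set p \<subseteq> arcs G \<and> length p \<le> card (verts G)}"
    by (rule finite_lists_length_le) simp
qed

section \<open>Coefficients of endomorphisms of a projective representation\<close>

text \<open>At an index \<open>(s, p)\<close> this is the path \<open>p\<close> as a basis vector of
  the summand \<open>s\<close>; for \<open>p = []\<close> it is the generator of that
  summand.\<close>

definition unit_vec :: "'b \<Rightarrow> 'b \<Rightarrow> 'k::field" where
  "unit_vec b = (\<lambda>b'. if b' = b then 1 else 0)"

text \<open>Acyclicity is encoded as finiteness of the set of paths, a form that passes to the split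
  quiver by comparing walks. The parameter \<open>K\<close> fixes the type of scalars.\<close>

locale projective_sum = fin_digraph Q for Q :: "('v, 'e) pre_digraph" +
  fixes d :: "'v \<Rightarrow> nat" and K :: "'k::field itself"
  assumes finite_walks: "finite {p. \<exists>i j. awalk i p j}"
begin

section \<open>Spaces and maps of the sum of projectives\<close>

definition summands :: "('v \<times> nat) set" where
  "summands = {(i, n). i \<in> verts Q \<and> n < d i}"

abbreviation P :: "('v, 'e, ('v \<times> nat) \<times> 'e list, 'k) quiver_rep" where
  "P \<equiv> proj_sum Q d"

lemma finite_summands: "finite summands"
proof -
  have "summands = (SIGMA i:verts Q. {..<d i})" by (auto simp: summands_def)
  then show ?thesis by simp
qed

lemma summands_verts: "s \<in> summands \<Longrightarrow> fst s \<in> verts Q"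
  by (auto simp: summands_def)

text \<open>As there are finitely many paths, finite support is automatic, and membership becomes a
  single condition on the support.\<close>

lemma space_iff: "x \<in> rep_space P j \<longleftrightarrow> (\<forall>s p. x (s, p) \<noteq> 0 \<longrightarrow> s \<in> summands \<and> awalk (fst s) p j)"
proof -
  have fin: "finite {c. x (s, c) \<noteq> 0}" if "\<And>c. x (s, c) \<noteq> 0 \<Longrightarrow> awalk (fst s) c j" for s
    by (rule finite_subset[OF _ finite_walks]) (use that in blast)
  have "x \<in> rep_space P j \<longleftrightarrow>
     (\<forall>s\<in>summands. finite {c. x (s, c) \<noteq> 0} \<and> (\<forall>c. x (s, c) \<noteq> 0 \<longrightarrow> awalk (fst s) c j)) \<and>
     (\<forall>s c. s \<notin> summands \<longrightarrow> x (s, c) = 0)"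
    unfolding proj_sum_def rep_sum_def summands_def[symmetric]
    by (simp add: proj_rep_def split_beta)
  also have "\<dots> \<longleftrightarrow> (\<forall>s p. x (s, p) \<noteq> 0 \<longrightarrow> s \<in> summands \<and> awalk (fst s) p j)"
    using fin by blast
  finally show ?thesis .
qed

lemma spaceD: "x \<in> rep_space P j \<Longrightarrow> x (s, p) \<noteq> 0 \<Longrightarrow> s \<in> summands \<and> awalk (fst s) p j"
  unfolding space_iff by blast

lemma finite_support: "x \<in> rep_space P j \<Longrightarrow> finite {b. x b \<noteq> 0}"
  by (rule finite_subset[of _ "summands \<times> {p. \<exists>i j. awalk i p j}"])
    (use spaceD in \<open>force simp: finite_summands finite_walks\<close>)+

text \<open>Appending an arrow is injective on paths, so the sum in \<open>proj_rep\<close> has at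
  most one nonzero term, the one at \<open>butlast p\<close>.\<close>

lemma map_apply:
  assumes x: "x \<in> rep_space P j"
  shows "rep_map P \<alpha> x (s, p) = (if p \<noteq> [] \<and> last p = \<alpha> then x (s, butlast p) else 0)"
proof (cases "s \<in> summands")
  case True
  have fin: "finite {c. x (s, c) \<noteq> 0}"
    by (rule finite_subset[OF _ finite_walks]) (use spaceD[OF x] in blast)
  have eq: "c @ [\<alpha>] = p \<longleftrightarrow> p \<noteq> [] \<and> last p = \<alpha> \<and> c = butlast p" for c
    by (cases p rule: rev_cases) auto
  have "rep_map P \<alpha> x (s, p) = (\<Sum>c | x (s, c) \<noteq> 0. if c @ [\<alpha>] = p then x (s, c) else 0)"
    using True unfolding proj_sum_def rep_sum_def summands_def[symmetric]
    by (simp add: proj_rep_def split_beta)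
  also have "\<dots> = (if p \<noteq> [] \<and> last p = \<alpha> then x (s, butlast p) else 0)"
    using fin by (auto simp: eq sum.delta)
  finally show ?thesis .
next
  case False
  then have "x (s, c) = 0" for c using spaceD[OF x] by blast
  then show ?thesis using False unfolding proj_sum_def rep_sum_def summands_def[symmetric] by simp
qed

lemma proj_sum_space_add:
  assumes "x \<in> rep_space P j" "y \<in> rep_space P j"
  shows "(\<lambda>b. x b + y b) \<in> rep_space P j"
  unfolding space_iff
proof (intro allI impI)
  fix s p assume "x (s, p) + y (s, p) \<noteq> 0"
  then have "x (s, p) \<noteq> 0 \<or> y (s, p) \<noteq> 0" by auto
  then show "s \<in> summands \<and> awalk (fst s) p j" using spaceD assms by blast
qed

lemma proj_sum_space_scale: "x \<in> rep_space P j \<Longrightarrow> (\<lambda>b. c * x b) \<in> rep_space P j"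
  by (auto simp: space_iff)

lemma proj_sum_map_linear: "linear_on (rep_space P j) (rep_map P \<alpha>)"
  unfolding linear_on_def
proof (intro conjI allI ballI ext)
  fix x y b assume *: "x \<in> rep_space P j" "y \<in> rep_space P j"
  show "rep_map P \<alpha> (\<lambda>b. x b + y b) b = rep_map P \<alpha> x b + rep_map P \<alpha> y b"
    by (cases b) (simp add: map_apply[OF proj_sum_space_add[OF *]] map_apply[OF *(1)] map_apply[OF *(2)])
next
  fix x c b assume *: "x \<in> rep_space P j"
  show "rep_map P \<alpha> (\<lambda>b. c * x b) b = c * rep_map P \<alpha> x b"
    by (cases b) (simp add: map_apply[OF proj_sum_space_scale[OF *]] map_apply[OF *])
qed

sublocale quiver_representation Q P
proof
  show "(\<lambda>b. 0) \<in> rep_space P j" for j by (simp add: space_iff)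
  show "rep_map P \<alpha> x \<in> rep_space P (head Q \<alpha>)"
    if \<alpha>: "\<alpha> \<in> arcs Q" and x: "x \<in> rep_space P (tail Q \<alpha>)" for \<alpha> x
  proof -
    have "s \<in> summands \<and> awalk (fst s) p (head Q \<alpha>)" if "rep_map P \<alpha> x (s, p) \<noteq> 0" for s p
    proof -
      from that have p: "p \<noteq> []" "last p = \<alpha>" "x (s, butlast p) \<noteq> 0"
        by (auto simp: map_apply[OF x] split: if_splits)
      then have "awalk (fst s) (butlast p @ [last p]) (head Q \<alpha>)"
        using spaceD[OF x p(3)] \<alpha> by (auto simp: awalk_Cons_iff awalk_Nil_iff)
      then show ?thesis unfolding append_butlast_last_id[OF p(1)] using spaceD[OF x p(3)] by simp
    qed
    then show ?thesis by (simp add: space_iff)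
  qed
qed (rule proj_sum_space_add proj_sum_space_scale proj_sum_map_linear; assumption)+

section \<open>Generation by the constant paths\<close>

lemma unit_vec_space:
  "s \<in> summands \<Longrightarrow> awalk (fst s) p j \<Longrightarrow> unit_vec (s, p) \<in> rep_space P j"
  by (auto simp: space_iff unit_vec_def)

lemma generator_space: "s \<in> summands \<Longrightarrow> unit_vec (s, []) \<in> rep_space P (fst s)"
  by (simp add: unit_vec_space summands_verts awalk_Nil_iff)

lemma map_unit_vec:
  assumes "s \<in> summands" "awalk (fst s) p j"
  shows "rep_map P \<alpha> (unit_vec (s, p)) = unit_vec (s, p @ [\<alpha>])"
proof (rule ext)
  fix b :: "('v \<times> nat) \<times> 'e list"
  obtain t r where b: "b = (t, r)" by (cases b)
  show "rep_map P \<alpha> (unit_vec (s, p)) b = unit_vec (s, p @ [\<alpha>]) b"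
    unfolding b map_apply[OF unit_vec_space[OF assms]]
    by (auto simp: unit_vec_def)
qed

text \<open>The arrow maps carry a generator to every path of its summand, and endomorphisms commute
  with them; linearity then extends the agreement from paths to all vectors.\<close>

lemma endos_eq_if_eq_on_generators:
  assumes f: "f \<in> carrier E" and g: "g \<in> carrier E"
    and eq: "\<And>s. s \<in> summands \<Longrightarrow> f (fst s) (unit_vec (s, [])) = g (fst s) (unit_vec (s, []))"
  shows "f = g"
proof (rule End_eqI[OF f g])
  note D = rep_endosD[OF End_endo[OF f]] and D' = rep_endosD[OF End_endo[OF g]]
  have path: "f j (unit_vec (s, p)) = g j (unit_vec (s, p))"
    if "s \<in> summands" "awalk (fst s) p j" for s p j
    using that
  proof (induction p arbitrary: j rule: rev_induct)
    case Nil
    then show ?case using eq[of s] by (auto simp: awalk_Nil_iff)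
  next
    case (snoc \<alpha> p)
    then have *: "awalk (fst s) p (tail Q \<alpha>)" "\<alpha> \<in> arcs Q" "j = head Q \<alpha>"
      by (auto simp: awalk_Cons_iff awalk_Nil_iff)
    have sp: "unit_vec (s, p) \<in> rep_space P (tail Q \<alpha>)"
      using unit_vec_space snoc.prems * by blast
    show ?case
      using D(4)[OF *(2) sp] D'(4)[OF *(2) sp] snoc.IH[OF snoc.prems(1) *(1)]
      by (simp add: map_unit_vec[OF snoc.prems(1) *(1)] *(3))
  qed
  fix j x assume j: "j \<in> verts Q" and x: "x \<in> rep_space P j"
  \<comment> \<open>Induction on a finite set containing the support: each step splits off the
    multiple of one basis vector.\<close>
  have "f j x = g j x" if "finite B" "{b. x b \<noteq> 0} \<subseteq> B" "x \<in> rep_space P j" for B x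
    using that
  proof (induction B arbitrary: x rule: finite_induct)
    case empty
    \<comment> \<open>Writing the zero vector as its own multiple by 0 lets homogeneity give the
      value 0 on both sides.\<close>
    then have "x = (\<lambda>b. 0 * 0)" by auto
    then show ?case using D(3)[OF j, of "\<lambda>_. 0" 0] D'(3)[OF j, of "\<lambda>_. 0" 0] space_zero[OF j]
      by simp
  next
    case (insert b B)
    show ?case
    proof (cases "x b = 0")
      case True
      then show ?thesis using insert by blast
    next
      case False
      obtain s p where b: "b = (s, p)" by (cases b)
      have sp: "unit_vec b \<in> rep_space P j" "f j (unit_vec b) = g j (unit_vec b)"
        using False spaceD[OF insert.prems(2)] path unit_vec_space unfolding b by blast+
      define y where "y = x(b := 0)"
      have y: "y \<in> rep_space P j"
        using insert.prems(2) by (simp add: space_iff y_def)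
      have xy: "x = (\<lambda>b'. y b' + x b * unit_vec b b')"
        by (auto simp: y_def unit_vec_def)
      have "f j y = g j y"
      proof (rule insert.IH[OF _ y])
        show "{b. y b \<noteq> 0} \<subseteq> B" using insert.prems(1) by (auto simp: y_def)
      qed
      then show ?thesis
        using sp j y D(2)[OF j y space_scale[OF j sp(1), of "x b"]]
          D'(2)[OF j y space_scale[OF j sp(1), of "x b"]]
        by (subst (1 2) xy) (simp add: D(3) D'(3))
    qed
  qed
  from this[OF finite_support[OF x] subset_refl x] show "f j x = g j x" .
qed

text \<open>
  \<open>coef f s t p\<close> is the coefficient of the path \<open>p\<close> of the summand \<open>t\<close> in the image under \<open>f\<close> of
  the generator of the summand \<open>s\<close>, so \<open>p\<close> runs backwards, from the vertex of \<open>t\<close> to that of \<open>s\<close>.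
\<close>

definition coeffs :: "('v \<times> nat \<Rightarrow> 'v \<times> nat \<Rightarrow> 'e list \<Rightarrow> 'k) set" where
  "coeffs = {\<phi>. \<forall>s t p. \<phi> s t p \<noteq> 0 \<longrightarrow> s \<in> summands \<and> t \<in> summands \<and> awalk (fst t) p (fst s)}"

definition coef :: "('v \<Rightarrow> (('v \<times> nat) \<times> 'e list \<Rightarrow> 'k) \<Rightarrow> (('v \<times> nat) \<times> 'e list \<Rightarrow> 'k))
    \<Rightarrow> 'v \<times> nat \<Rightarrow> 'v \<times> nat \<Rightarrow> 'e list \<Rightarrow> 'k" where
  "coef f s t p = (if s \<in> summands then f (fst s) (unit_vec (s, [])) (t, p) else 0)"

text \<open>If the generator of \<open>s\<close> goes to a combination of paths \<open>p\<close> of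
  \<open>t\<close>, then the path \<open>c\<close> of \<open>s\<close> goes to the same combination
  of the paths \<open>p @ c\<close>. The coefficient at \<open>r\<close> is therefore a sum over all
  ways to cut \<open>r\<close> into a prefix from \<open>\<phi>\<close> and a suffix from
  \<open>x\<close>, both trivial cuts included.\<close>

definition act :: "('v \<times> nat \<Rightarrow> 'v \<times> nat \<Rightarrow> 'e list \<Rightarrow> 'k) \<Rightarrow> (('v \<times> nat) \<times> 'e list \<Rightarrow> 'k)
    \<Rightarrow> ('v \<times> nat) \<times> 'e list \<Rightarrow> 'k" where
  "act \<phi> x = (\<lambda>(t, r). \<Sum>s\<in>summands. \<Sum>k\<le>length r. x (s, drop k r) * \<phi> s t (take k r))"

definition endo :: "('v \<times> nat \<Rightarrow> 'v \<times> nat \<Rightarrow> 'e list \<Rightarrow> 'k)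
    \<Rightarrow> 'v \<Rightarrow> (('v \<times> nat) \<times> 'e list \<Rightarrow> 'k) \<Rightarrow> (('v \<times> nat) \<times> 'e list \<Rightarrow> 'k)" where
  "endo \<phi> = (\<lambda>j\<in>verts Q. \<lambda>x\<in>rep_space P j. act \<phi> x)"

section \<open>Coefficient arrays as endomorphisms\<close>

lemma act_nonzero:
  assumes "act \<phi> x (t, r) \<noteq> 0"
  obtains s k where "s \<in> summands" "k \<le> length r" "x (s, drop k r) \<noteq> 0" "\<phi> s t (take k r) \<noteq> 0"
proof -
  from assms obtain s where s: "s \<in> summands"
    "(\<Sum>k\<le>length r. x (s, drop k r) * \<phi> s t (take k r)) \<noteq> 0"
    unfolding act_def by (auto elim: sum.not_neutral_contains_not_neutral)
  then obtain k where "k \<le> length r" "x (s, drop k r) * \<phi> s t (take k r) \<noteq> 0"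
    by (auto elim: sum.not_neutral_contains_not_neutral)
  then show ?thesis using that s by auto
qed

lemma coeffsD: "\<phi> \<in> coeffs \<Longrightarrow> \<phi> s t p \<noteq> 0 \<Longrightarrow> s \<in> summands \<and> t \<in> summands \<and> awalk (fst t) p (fst s)"
  unfolding coeffs_def by blast

lemma act_space:
  assumes "\<phi> \<in> coeffs" "x \<in> rep_space P j"
  shows "act \<phi> x \<in> rep_space P j"
  unfolding space_iff
proof clarify
  fix i n r assume "act \<phi> x ((i, n), r) \<noteq> 0"
  then obtain s k where "x (s, drop k r) \<noteq> 0" "\<phi> s (i, n) (take k r) \<noteq> 0"
    by (rule act_nonzero)
  then have "(i, n) \<in> summands" "awalk i (take k r) (fst s)" "awalk (fst s) (drop k r) j"
    using coeffsD[OF assms(1)] spaceD[OF assms(2)] by fastforce+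
  then show "(i, n) \<in> summands \<and> awalk (fst (i, n)) r j"
    using awalk_appendI[of i "take k r" "fst s" "drop k r" j] by simp
qed

text \<open>The arrow map appends at the right end of a path and \<open>\<phi>\<close> inserts at
  the left end, so the two operations commute.\<close>

lemma act_map:
  assumes \<phi>: "\<phi> \<in> coeffs" and \<alpha>: "\<alpha> \<in> arcs Q" and x: "x \<in> rep_space P (tail Q \<alpha>)"
  shows "act \<phi> (rep_map P \<alpha> x) = rep_map P \<alpha> (act \<phi> x)"
proof (rule ext)
  fix b :: "('v \<times> nat) \<times> 'e list"
  obtain t r where b: "b = (t, r)" by (cases b)
  show "act \<phi> (rep_map P \<alpha> x) b = rep_map P \<alpha> (act \<phi> x) b"
  proof (cases r rule: rev_cases)
    case Nil
    then show ?thesis unfolding b map_apply[OF act_space[OF \<phi> x]]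
      by (simp add: act_def map_apply[OF x])
  next
    case (snoc q \<beta>)
    \<comment> \<open>The cut \<open>k = Suc (length q)\<close> leaves the empty suffix, where the
      image of the arrow map vanishes. All other cuts leave a suffix ending in
      \<open>\<beta>\<close>.\<close>
    have "act \<phi> (rep_map P \<alpha> x) b =
      (\<Sum>s\<in>summands. \<Sum>k\<le>length q. (if \<beta> = \<alpha> then x (s, drop k q) else 0) * \<phi> s t (take k q))"
      unfolding b snoc act_def prod.case length_append_singleton sum.atMost_Suc
      by (intro sum.cong refl) (auto simp: map_apply[OF x] intro!: sum.cong)
    also have "\<dots> = (if \<beta> = \<alpha> then act \<phi> x (t, q) else 0)"
      by (simp add: act_def)
    finally show ?thesis
      unfolding b map_apply[OF act_space[OF \<phi> x]] snoc by simp
  qed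
qed

lemma act_add: "act \<phi> (\<lambda>b. x b + y b) = (\<lambda>b. act \<phi> x b + act \<phi> y b)"
  by (auto simp: act_def sum.distrib distrib_right)

lemma act_scale: "act \<phi> (\<lambda>b. c * x b) = (\<lambda>b. c * act \<phi> x b)"
  by (auto simp: act_def sum_distrib_left mult.assoc)

lemma endo_closed: "\<phi> \<in> coeffs \<Longrightarrow> endo \<phi> \<in> carrier E"
  unfolding End_algebra_def endo_def
  by (simp, rule rep_endosI) (simp_all add: act_space act_map act_add act_scale)

lemma act_generator:
  assumes "s \<in> summands"
  shows "act \<phi> (unit_vec (s, [])) (t, r) = \<phi> s t r"
proof -
  have "(\<Sum>k\<le>length r. unit_vec (s, []) (s', drop k r) * \<phi> s' t (take k r)) =
      (if s' = s then \<phi> s t r else 0)" for s'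
  proof -
    \<comment> \<open>The generator is supported on the constant path, so the cut must leave the
      empty suffix.\<close>
    have "(\<Sum>k\<le>length r. unit_vec (s, []) (s', drop k r) * \<phi> s' t (take k r)) =
        (\<Sum>k\<le>length r. if k = length r then if s' = s then \<phi> s t r else 0 else 0)"
      by (intro sum.cong refl) (auto simp: unit_vec_def)
    then show ?thesis by simp
  qed
  then show ?thesis using assms by (simp add: act_def finite_summands)
qed

lemma coef_endo:
  assumes "\<phi> \<in> coeffs"
  shows "coef (endo \<phi>) = \<phi>"
proof -
  have "coef (endo \<phi>) s t r = \<phi> s t r" for s t r
    using coeffsD[OF assms, of s t r]
    by (auto simp: coef_def endo_def summands_verts generator_space act_generator)
  then show ?thesis by blast
qed

lemma coef_closed:
  assumes f: "f \<in> carrier E"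
  shows "coef f \<in> coeffs"
proof -
  have "s \<in> summands \<and> t \<in> summands \<and> awalk (fst t) p (fst s)" if "coef f s t p \<noteq> 0" for s t p
  proof -
    from that have s: "s \<in> summands" "f (fst s) (unit_vec (s, [])) (t, p) \<noteq> 0"
      by (auto simp: coef_def split: if_splits)
    have "f (fst s) (unit_vec (s, [])) \<in> rep_space P (fst s)"
      using rep_endosD(1)[OF End_endo[OF f] summands_verts generator_space] s by blast
    then show ?thesis using s spaceD by blast
  qed
  then show ?thesis unfolding coeffs_def by blast
qed

text \<open>Both sides send each generator to the same vector. Together with
  \<open>coef_endo\<close> this identifies the endomorphisms with the arrays in
  \<open>coeffs\<close>.\<close>

lemma endo_coef:
  assumes f: "f \<in> carrier E"
  shows "endo (coef f) = f"
proof (rule endos_eq_if_eq_on_generators[OF endo_closed[OF coef_closed[OF f]] f])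
  fix s assume "s \<in> summands"
  then show "endo (coef f) (fst s) (unit_vec (s, [])) = f (fst s) (unit_vec (s, []))"
    by (auto simp: endo_def summands_verts generator_space act_generator coef_def fun_eq_iff)
qed

section \<open>The algebra operations in terms of coefficients\<close>

lemma coef_inject: "f \<in> carrier E \<Longrightarrow> g \<in> carrier E \<Longrightarrow> coef f = coef g \<longleftrightarrow> f = g"
  by (metis endo_coef)

text \<open>Applying \<open>g\<close> to the generator of \<open>s\<close> gives paths of
  \<open>t\<close>, and \<open>f\<close> then puts paths of \<open>u\<close> in front of them. Hence
  the suffix belongs to \<open>g\<close> and the prefix to \<open>f\<close>.\<close>

lemma coef_mult:
  assumes f: "f \<in> carrier E" and g: "g \<in> carrier E"
  shows "coef (f \<otimes>\<^bsub>E\<^esub> g) s u r =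
    (\<Sum>t\<in>summands. \<Sum>k\<le>length r. coef g s t (drop k r) * coef f t u (take k r))"
proof (cases "s \<in> summands")
  case True
  then have sp: "g (fst s) (unit_vec (s, [])) \<in> rep_space P (fst s)"
    using rep_endosD(1)[OF End_endo[OF g] summands_verts generator_space] by blast
  have "coef (f \<otimes>\<^bsub>E\<^esub> g) s u r = f (fst s) (g (fst s) (unit_vec (s, []))) (u, r)"
    using True by (simp add: coef_def End_apply summands_verts generator_space)
  also have "\<dots> = endo (coef f) (fst s) (g (fst s) (unit_vec (s, []))) (u, r)"
    by (simp add: endo_coef[OF f])
  also have "\<dots> = act (coef f) (g (fst s) (unit_vec (s, []))) (u, r)"
    using True sp by (simp add: endo_def summands_verts)
  also have "\<dots> = (\<Sum>t\<in>summands. \<Sum>k\<le>length r. coef g s t (drop k r) * coef f t u (take k r))"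
    using True by (simp add: act_def coef_def)
  finally show ?thesis .
qed (simp add: coef_def)

lemma coef_add: "coef (f \<oplus>\<^bsub>E\<^esub> g) s t p = coef f s t p + coef g s t p"
  by (simp add: coef_def End_apply summands_verts generator_space)

lemma coef_smult: "coef (c \<odot>\<^bsub>E\<^esub> f) s t p = c * coef f s t p"
  by (simp add: coef_def End_apply summands_verts generator_space)

lemma coef_zero: "coef \<zero>\<^bsub>E\<^esub> s t p = 0"
  by (simp add: coef_def End_apply summands_verts generator_space)

lemma coef_one: "coef \<one>\<^bsub>E\<^esub> s t p = (if s \<in> summands \<and> t = s \<and> p = [] then 1 else 0)"
  by (simp add: coef_def End_apply summands_verts generator_space) (simp add: unit_vec_def)

end

section \<open>The Jacobson radical of the endomorphism algebra\<close>

context projective_sum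
begin

text \<open>The empty path has a single cut, so the constant-path coefficients multiply as matrices
  among themselves.\<close>

lemma coef_mult_Nil:
  assumes "f \<in> carrier E" "g \<in> carrier E"
  shows "coef (f \<otimes>\<^bsub>E\<^esub> g) s u [] = (\<Sum>t\<in>summands. coef g s t [] * coef f t u [])"
  by (simp add: coef_mult[OF assms])

text \<open>
  The matrix of constant-path coefficients of \<open>f\<close> is its image in the semisimple quotient, so
  these are the left ideals of matrices that vanish on a given standard basis vector.
\<close>

lemma maximal_left_ideal_coef:
  assumes s: "s \<in> summands"
  shows "maximal_left_ideal {f \<in> carrier E. \<forall>t. coef f s t [] = 0} E" (is "maximal_left_ideal ?L E")
  unfolding maximal_left_ideal_def
proof (intro conjI allI impI)
  interpret R: ring E by (rule End_ring)
  show "left_ideal ?L E"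
    by (rule R.left_idealI) (auto simp: coef_zero coef_add coef_mult_Nil simp del: split_paired_All)
  \<comment> \<open>The identity has a nonzero entry in row \<open>s\<close>, so the left ideal is
    proper.\<close>
  have "coef \<one>\<^bsub>E\<^esub> s s [] = 1" using s by (simp add: coef_one)
  moreover have "coef \<one>\<^bsub>E\<^esub> s s [] = 0" if "?L = carrier E"
    using End_one_zero(1) equalityD2[OF that] by blast
  ultimately show "?L \<noteq> carrier E" by auto
  fix J assume J: "left_ideal J E \<and> ?L \<subseteq> J"
  note JD = R.left_idealD[OF conjunct1[OF J]]
  show "J = ?L \<or> J = carrier E"
  proof (rule disjCI)
    assume "J \<noteq> carrier E"
    show "J = ?L"
    proof (rule ccontr)
      assume "J \<noteq> ?L"
      then obtain g t where g: "g \<in> J" "g \<in> carrier E" "coef g s t [] \<noteq> 0"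
        using J JD(1) by blast
      define c where "c = coef g s t []"
      \<comment> \<open>A matrix unit scaled to move the nonzero entry of row \<open>s\<close> from
        column \<open>t\<close> to column \<open>s\<close> and normalize it. Row \<open>s\<close> of
        \<open>h\<close> then equals row \<open>s\<close> of the identity.\<close>
      define \<phi> where "\<phi> = (\<lambda>t' u p. if t' = t \<and> u = s \<and> p = ([] :: 'e list) then inverse c else 0)"
      \<comment> \<open>A nonzero constant-path coefficient forces \<open>s\<close> and
        \<open>t\<close> to lie at the same vertex, which makes \<open>\<phi>\<close> a legitimate
        array.\<close>
      have t: "t \<in> summands" "awalk (fst s) [] (fst t)"
        using coeffsD[OF coef_closed[OF g(2)] g(3)] by (auto simp: awalk_Nil_iff)
      have \<phi>: "\<phi> \<in> coeffs"
        using s t by (auto simp: coeffs_def \<phi>_def)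
      define h where "h = endo \<phi> \<otimes>\<^bsub>E\<^esub> g"
      have hJ: "h \<in> J" unfolding h_def by (rule JD(4)[OF endo_closed[OF \<phi>] g(1)])
      then have h: "h \<in> carrier E" using JD(1) by blast
      have coef_h: "coef h s u [] = (if u = s then 1 else 0)" for u
      proof -
        have "coef h s u [] = (\<Sum>t'\<in>summands. if t' = t then if u = s then 1 else 0 else 0)"
          unfolding h_def coef_mult_Nil[OF endo_closed[OF \<phi>] g(2)] coef_endo[OF \<phi>]
          using g(3) by (intro sum.cong) (auto simp: \<phi>_def c_def)
        then show ?thesis using t finite_summands by simp
      qed
      \<comment> \<open>The difference \<open>1 - h\<close> has zero row \<open>s\<close>, so it
        lies in the smaller ideal and thus in \<open>J\<close>; adding \<open>h\<close> back puts
        the identity into \<open>J\<close>.\<close>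
      define z where "z = \<one>\<^bsub>E\<^esub> \<oplus>\<^bsub>E\<^esub> ((- 1) \<odot>\<^bsub>E\<^esub> h)"
      have z: "z \<in> carrier E"
        unfolding z_def by (intro End_closed(2) End_closed(3)[OF h h] End_one_zero)
      have "coef z s u [] = 0" for u
        using s by (simp add: z_def coef_add coef_smult coef_one coef_h)
      then have "z \<in> J" using z J by blast
      moreover have "\<one>\<^bsub>E\<^esub> = z \<oplus>\<^bsub>E\<^esub> h"
        by (rule End_eqI[OF End_one_zero(1) End_closed(2)[OF z h]]) (simp add: End_apply z_def)
      ultimately have "\<one>\<^bsub>E\<^esub> \<in> J" using JD(3) hJ by simp
      then show False using JD(5) \<open>J \<noteq> carrier E\<close> by blast
    qed
  qed
qed

text \<open>Each factor without constant paths contributes at least one arrow to every path that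
  occurs in the power.\<close>

lemma pow_coef_length:
  assumes f: "f \<in> carrier E" and nil: "\<And>s t. coef f s t [] = 0"
  shows "coef (f [^]\<^bsub>E\<^esub> (k::nat)) s u r \<noteq> 0 \<Longrightarrow> k \<le> length r"
proof (induction k arbitrary: s u r)
  case (Suc k)
  interpret R: ring E by (rule End_ring)
  from Suc.prems have
    "(\<Sum>t\<in>summands. \<Sum>i\<le>length r. coef f s t (drop i r) * coef (f [^]\<^bsub>E\<^esub> k) t u (take i r)) \<noteq> 0"
    using f by (simp add: coef_mult)
  then obtain t where "(\<Sum>i\<le>length r. coef f s t (drop i r) * coef (f [^]\<^bsub>E\<^esub> k) t u (take i r)) \<noteq> 0"
    by (auto elim: sum.not_neutral_contains_not_neutral)
  then obtain i where i: "i \<le> length r" "coef f s t (drop i r) \<noteq> 0"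
      "coef (f [^]\<^bsub>E\<^esub> k) t u (take i r) \<noteq> 0"
    by (auto elim: sum.not_neutral_contains_not_neutral)
  \<comment> \<open>An empty suffix would be a constant path of \<open>f\<close>. So the prefix is
    strictly shorter than \<open>r\<close>, which gains the one in \<open>Suc k\<close>.\<close>
  have "i < length r"
  proof (rule ccontr)
    assume "\<not> i < length r"
    then show False using i(2) nil by simp
  qed
  then show ?case using Suc.IH[OF i(3)] by simp
qed simp

lemma nil_coef_nilpotent:
  assumes f: "f \<in> carrier E" and nil: "\<And>s t. coef f s t [] = 0"
  shows "\<exists>k::nat. f [^]\<^bsub>E\<^esub> k = \<zero>\<^bsub>E\<^esub>"
proof -
  interpret R: ring E by (rule End_ring)
  \<comment> \<open>Larger than the length of every path, so no path is long enough to occur in the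
    power.\<close>
  define k where "k = Suc (Max (length ` {p. \<exists>i j. awalk i p j}))"
  have "coef (f [^]\<^bsub>E\<^esub> k) s t p = 0" for s t p
  proof (rule ccontr)
    assume *: "coef (f [^]\<^bsub>E\<^esub> k) s t p \<noteq> 0"
    then have "awalk (fst t) p (fst s)"
      using coeffsD[OF coef_closed[OF R.nat_pow_closed[OF f]]] by blast
    then have "length p < k"
      unfolding k_def using finite_walks by (auto intro!: Max_ge simp: less_Suc_eq_le)
    then show False using pow_coef_length[OF f nil *] by simp
  qed
  then have "coef (f [^]\<^bsub>E\<^esub> k) = coef \<zero>\<^bsub>E\<^esub>" by (auto simp: coef_zero fun_eq_iff)
  then show ?thesis using coef_inject[OF R.nat_pow_closed[OF f] End_one_zero(2)] by blast
qed

text \<open>For each summand \<open>s\<close>, membership in the maximal left ideal of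
  \<open>s\<close> kills row \<open>s\<close> of the constant-path matrix; rows outside
  \<open>summands\<close> vanish by definition of \<open>coef\<close>. Conversely, the elements with
  zero matrix form a nil left ideal.\<close>

lemma jacobson_radical_iff:
  "f \<in> jacobson_radical E \<longleftrightarrow> f \<in> carrier E \<and> (\<forall>s t. coef f s t [] = 0)"
proof
  assume f: "f \<in> jacobson_radical E"
  then have fc: "f \<in> carrier E" by (simp add: jacobson_radical_def)
  have "coef f s t [] = 0" for s t
  proof (cases "s \<in> summands")
    case True
    then show ?thesis using f maximal_left_ideal_coef[of s] unfolding jacobson_radical_def by blast
  qed (simp add: coef_def)
  then show "f \<in> carrier E \<and> (\<forall>s t. coef f s t [] = 0)" using fc by blast
next
  interpret R: ring E by (rule End_ring)
  let ?N = "{f \<in> carrier E. \<forall>s t. coef f s t [] = 0}"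
  have "left_ideal ?N E"
    by (rule R.left_idealI) (auto simp: coef_zero coef_add coef_mult_Nil simp del: split_paired_All)
  then have "?N \<subseteq> jacobson_radical E"
    using nil_coef_nilpotent by (intro R.nil_left_ideal_subset_jacobson_radical) auto
  then show "f \<in> jacobson_radical E" if "f \<in> carrier E \<and> (\<forall>s t. coef f s t [] = 0)"
    using that by blast
qed

lemma ideal_jacobson_radical: "ideal (jacobson_radical E) E"
proof (rule idealI[OF End_ring])
  interpret R: ring E by (rule End_ring)
  have "left_ideal (jacobson_radical E) E"
    by (rule R.left_idealI) (auto simp: jacobson_radical_iff coef_zero coef_add coef_mult_Nil simp del: split_paired_All)
  then show "subgroup (jacobson_radical E) (add_monoid E)"
    by (simp add: left_ideal_def additive_subgroup_def)
qed (auto simp: jacobson_radical_iff coef_mult_Nil End_closed simp del: split_paired_All)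

end

section \<open>Splitting the sink\<close>

text \<open>The vertex map of the quiver morphism from the split quiver back to \<open>Q\<close>; on
  arrows it is the identity, since \<open>split_quiver\<close> keeps their labels.\<close>

fun unsplit :: "'v \<Rightarrow> 'v split_vertex \<Rightarrow> 'v" where
  "unsplit v (Old i) = i"
| "unsplit v SplitA = v"
| "unsplit v SplitB = v"

locale split_sink = X: projective_sum Q d K
  for Q :: "('v, 'e) pre_digraph" and d :: "'v \<Rightarrow> nat" and K :: "'k::field itself" +
  fixes v :: 'v and \<A> \<B> :: "'e set"
  assumes v: "v \<in> verts Q" and sink: "out_arcs Q v = {}"
    and parts: "\<A> \<union> \<B> = in_arcs Q v"
begin

section \<open>Arrows and paths of the split quiver\<close>

abbreviation "Q' \<equiv> split_quiver Q v \<A> \<B>"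

lemma arcs_split: "arcs Q' = arcs Q"
  using parts by (auto simp: split_quiver_def in_arcs_def)

lemma tail_split: "tail Q' e = Old (tail Q e)"
  by (simp add: split_quiver_def)

lemma verts_split: "verts Q' = Old ` (verts Q - {v}) \<union> {SplitA, SplitB}"
  by (simp add: split_quiver_def)

lemma tail_not_sink: "e \<in> arcs Q \<Longrightarrow> tail Q e \<noteq> v"
  using sink by (auto simp: out_arcs_def)

lemma unsplit_head: "e \<in> arcs Q \<Longrightarrow> unsplit v (head Q' e) = head Q e"
  using parts by (auto simp: split_quiver_def in_arcs_def)

lemma head_split: "e \<in> arcs Q \<Longrightarrow> head Q e \<noteq> v \<Longrightarrow> head Q' e = Old (head Q e)"
  using parts by (auto simp: split_quiver_def in_arcs_def)

lemma fin_digraph_split: "fin_digraph Q'"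
proof
  fix e assume "e \<in> arcs Q'"
  then have e: "e \<in> arcs Q" by (simp add: arcs_split)
  then show "tail Q' e \<in> verts Q'"
    using tail_not_sink by (auto simp: tail_split verts_split)
  show "head Q' e \<in> verts Q'"
    using e parts by (auto simp: split_quiver_def in_arcs_def)
next
  show "finite (verts Q')" by (simp add: verts_split)
  show "finite (arcs Q')" by (simp add: arcs_split)
qed

text \<open>A nonempty walk passes only through tails of arrows before its end, hence never through
  the sink. So the same list of arrows is a walk in both quivers, and its last arrow decides which
  half is reached. The constant path at \<open>v\<close>, by contrast, has two counterparts.\<close>

lemma awalk_split_iff:
  assumes "p \<noteq> []"
  shows "pre_digraph.awalk Q' x p y \<longleftrightarrow>
    y = head Q' (last p) \<and> x \<in> range Old \<and> X.awalk (unsplit v x) p (unsplit v y)"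
  using assms
proof (induction p arbitrary: x)
  case (Cons e q)
  interpret Y: fin_digraph Q' by (rule fin_digraph_split)
  show ?case
  proof (cases "q = []")
    case True
    then show ?thesis
      using Y.head_in_verts[of e]
      by (auto simp: Y.awalk_Cons_iff Y.awalk_Nil_iff X.awalk_Cons_iff X.awalk_Nil_iff
          arcs_split tail_split unsplit_head)
  next
    case False
    \<comment> \<open>The rest \<open>q\<close> is nonempty and leaves the head of \<open>e\<close>,
      so this head is not the sink and keeps its \<open>Old\<close> label.\<close>
    have "head Q' e \<in> range Old \<and> X.awalk (unsplit v (head Q' e)) q z \<longleftrightarrow>
        X.awalk (head Q e) q z" if "e \<in> arcs Q" for z
    proof -
      have "head Q e \<noteq> v" if "X.awalk (head Q e) q z"
        using that False tail_not_sink by (cases q) (auto simp: X.awalk_Cons_iff)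
      then show ?thesis using head_split that by (auto simp: unsplit_head)
    qed
    then have "Y.awalk x (e # q) y \<longleftrightarrow> e \<in> arcs Q \<and> x = Old (tail Q e) \<and>
        y = head Q' (last q) \<and> X.awalk (head Q e) q (unsplit v y)"
      unfolding Y.awalk_Cons_iff Cons.IH[OF False] arcs_split tail_split by blast
    then show ?thesis using False by (auto simp: X.awalk_Cons_iff)
  qed
qed simp

sublocale Y: projective_sum Q' "split_dim d v" K
proof -
  interpret Y: fin_digraph Q' by (rule fin_digraph_split)
  show "projective_sum Q'"
  proof
    \<comment> \<open>Apart from the constant path, every walk of the split quiver is the same list
      as some walk of \<open>Q\<close>.\<close>
    show "finite {p. \<exists>i j. Y.awalk i p j}"
      by (rule finite_subset[of _ "insert [] {p. \<exists>i j. X.awalk i p j}"])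
        (use awalk_split_iff X.finite_walks in blast)+
  qed
qed

section \<open>Correspondence of summands\<close>

definition orig :: "'v split_vertex \<times> nat \<Rightarrow> 'v \<times> nat" where
  "orig s = (unsplit v (fst s), snd s)"

lemma orig_summands: "s \<in> Y.summands \<Longrightarrow> orig s \<in> X.summands"
  using v by (auto simp: X.summands_def Y.summands_def orig_def verts_split)

lemma Old_summands: "s \<in> X.summands \<Longrightarrow> fst s \<noteq> v \<Longrightarrow> (Old (fst s), snd s) \<in> Y.summands"
  by (auto simp: X.summands_def Y.summands_def verts_split)

text \<open>The end of a nonconstant path lifts to the head of its last arrow in \<open>Q'\<close>.
  The copy number stays valid because \<open>split_dim\<close> is \<open>d\<close> composed with
  \<open>unsplit v\<close>.\<close>

lemma head_summands:
  assumes "s \<in> X.summands" "p \<noteq> []" "X.awalk i p (fst s)"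
  shows "(head Q' (last p), snd s) \<in> Y.summands" "orig (head Q' (last p), snd s) = s"
proof -
  obtain q e where p: "p = q @ [e]" using assms(2) by (cases p rule: rev_cases) auto
  have e: "e \<in> arcs Q" "head Q e = fst s" using assms(3) p by (auto simp: X.awalk_Cons_iff X.awalk_Nil_iff)
  have "head Q' e \<in> verts Q'"
    using e(1) by (simp add: arcs_split)
  moreover have "split_dim d v y = d (unsplit v y)" for y by (cases y) simp_all
  moreover have "snd s < d (head Q e)" using assms(1) e(2) by (auto simp: X.summands_def)
  ultimately show "(head Q' (last p), snd s) \<in> Y.summands"
    using p e(1) by (simp add: Y.summands_def unsplit_head)
  show "orig (head Q' (last p), snd s) = s"
    using e p by (simp add: orig_def unsplit_head)
qed

section \<open>Transfer of coefficient arrays\<close>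

definition split_index :: "'v split_vertex \<times> nat \<Rightarrow> 'v split_vertex \<times> nat \<Rightarrow> 'e list \<Rightarrow> bool" where
  "split_index s t p \<longleftrightarrow> s \<in> Y.summands \<and> t \<in> Y.summands \<and> p \<noteq> [] \<and> Y.awalk (fst t) p (fst s)"

lemma split_index_iff:
  "split_index s t p \<longleftrightarrow> s \<in> Y.summands \<and> t \<in> Y.summands \<and> p \<noteq> [] \<and> fst s = head Q' (last p) \<and>
     fst t \<in> range Old \<and> X.awalk (fst (orig t)) p (fst (orig s))"
  using awalk_split_iff[of p "fst t" "fst s"] unfolding split_index_def orig_def fst_conv by blast

text \<open>Pullback along \<open>orig\<close>, cut off at positions carrying no nonconstant path of
  \<open>Q'\<close>. In particular an entry ending at \<open>v\<close> survives only at the half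
  that its last arrow reaches.\<close>

definition split_coef where
  "split_coef \<phi> = (\<lambda>s t p. if split_index s t p then \<phi> (orig s) (orig t) p else (0 :: 'k))"

text \<open>The inverse of \<open>split_coef\<close> on arrays without constant paths. The path runs
  from \<open>t\<close> to \<open>s\<close>: its start is never the sink and lifts to
  \<open>Old\<close>, its end lifts by the last arrow.\<close>

definition merge_coef where
  "merge_coef \<psi> = (\<lambda>s t p. if s \<in> X.summands \<and> t \<in> X.summands \<and> p \<noteq> [] \<and> X.awalk (fst t) p (fst s)
     then \<psi> (head Q' (last p), snd s) (Old (fst t), snd t) p else (0 :: 'k))"

abbreviation "rad_coeffs_X \<equiv> {\<phi> \<in> X.coeffs. \<forall>s t. \<phi> s t [] = 0}"
abbreviation "rad_coeffs_Y \<equiv> {\<psi> \<in> Y.coeffs. \<forall>s t. \<psi> s t [] = 0}"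

lemma split_coef_closed: "split_coef \<phi> \<in> rad_coeffs_Y"
  by (auto simp: Y.coeffs_def split_coef_def split_index_def)

lemma merge_coef_closed: "merge_coef \<psi> \<in> rad_coeffs_X"
  by (auto simp: X.coeffs_def merge_coef_def)

lemma path_source_not_sink: "X.awalk i p j \<Longrightarrow> p \<noteq> [] \<Longrightarrow> i \<noteq> v"
  using tail_not_sink by (cases p) (auto simp: X.awalk_Cons_iff)

lemma split_index_lift:
  assumes "s \<in> X.summands" "t \<in> X.summands" "p \<noteq> []" "X.awalk (fst t) p (fst s)"
  shows "split_index (head Q' (last p), snd s) (Old (fst t), snd t) p"
proof -
  have "fst (orig (Old (fst t), snd t)) = fst t" by (simp add: orig_def)
  then show ?thesis
    using assms head_summands[OF assms(1,3,4)] Old_summands[OF assms(2) path_source_not_sink[OF assms(4,3)]]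
    unfolding split_index_iff by simp
qed

lemma merge_split:
  assumes "\<phi> \<in> rad_coeffs_X"
  shows "merge_coef (split_coef \<phi>) = \<phi>"
proof (intro ext)
  fix s t p
  show "merge_coef (split_coef \<phi>) s t p = \<phi> s t p"
  proof (cases "s \<in> X.summands \<and> t \<in> X.summands \<and> p \<noteq> [] \<and> X.awalk (fst t) p (fst s)")
    case True
    then show ?thesis
      using split_index_lift head_summands(2)[of s p "fst t"]
      by (simp add: merge_coef_def split_coef_def) (simp add: orig_def)
  next
    case False
    then have "\<phi> s t p = 0" using assms X.coeffsD[of \<phi> s t p] by blast
    then show ?thesis using False by (auto simp: merge_coef_def)
  qed
qed

lemma split_merge:
  assumes "\<psi> \<in> rad_coeffs_Y"
  shows "split_coef (merge_coef \<psi>) = \<psi>"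
proof (intro ext)
  fix s t p
  show "split_coef (merge_coef \<psi>) s t p = \<psi> s t p"
  proof (cases "split_index s t p")
    case True
    have "(head Q' (last p), snd (orig s)) = s" "(Old (fst (orig t)), snd (orig t)) = t"
      using True unfolding split_index_iff by (auto simp: orig_def prod_eq_iff)
    moreover have "orig s \<in> X.summands" "orig t \<in> X.summands" "p \<noteq> []" "X.awalk (fst (orig t)) p (fst (orig s))"
      using True orig_summands unfolding split_index_iff by blast+
    ultimately show ?thesis
      using True by (simp add: split_coef_def merge_coef_def)
  next
    case False
    then have "\<psi> s t p = 0"
      using assms Y.coeffsD[of \<psi> s t p] unfolding split_index_def by blast
    then show ?thesis using False by (simp add: split_coef_def)
  qed
qed

section \<open>The isomorphism of the radicals\<close>

definition split_endo where
  "split_endo f = Y.endo (split_coef (X.coef f))"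

lemma coef_split_endo: "Y.coef (split_endo f) = split_coef (X.coef f)"
  using Y.coef_endo split_coef_closed by (auto simp: split_endo_def)

lemma split_endo_radical: "split_endo f \<in> jacobson_radical Y.E"
  using Y.endo_closed split_coef_closed[of "X.coef f"]
  by (simp add: Y.jacobson_radical_iff coef_split_endo) (simp add: split_endo_def)

lemma split_endo_eqI:
  assumes "g \<in> jacobson_radical Y.E"
    and "\<And>s t p. split_coef (X.coef f) s t p = Y.coef g s t p"
  shows "split_endo f = g"
proof -
  have "Y.coef (split_endo f) = Y.coef g" using assms(2) by (simp add: coef_split_endo fun_eq_iff)
  then show ?thesis
    using Y.coef_inject split_endo_radical[of f] assms(1) by (simp add: Y.jacobson_radical_iff)
qed

lemma bij_split_endo: "bij_betw split_endo (jacobson_radical X.E) (jacobson_radical Y.E)"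
proof (rule bij_betw_byWitness[where f' = "\<lambda>g. X.endo (merge_coef (Y.coef g))"])
  show "\<forall>f\<in>jacobson_radical X.E. X.endo (merge_coef (Y.coef (split_endo f))) = f"
  proof
    fix f assume "f \<in> jacobson_radical X.E"
    then have "f \<in> carrier X.E" "X.coef f \<in> rad_coeffs_X"
      using X.coef_closed by (auto simp: X.jacobson_radical_iff)
    then show "X.endo (merge_coef (Y.coef (split_endo f))) = f"
      by (simp only: coef_split_endo merge_split X.endo_coef)
  qed
  show "\<forall>g\<in>jacobson_radical Y.E. split_endo (X.endo (merge_coef (Y.coef g))) = g"
  proof
    fix g assume "g \<in> jacobson_radical Y.E"
    then have g: "g \<in> carrier Y.E" "Y.coef g \<in> rad_coeffs_Y"
      using Y.coef_closed by (auto simp: Y.jacobson_radical_iff)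
    have "merge_coef (Y.coef g) \<in> X.coeffs" using merge_coef_closed by blast
    then show "split_endo (X.endo (merge_coef (Y.coef g))) = g"
      by (simp only: split_endo_def X.coef_endo split_merge[OF g(2)] Y.endo_coef[OF g(1)])
  qed
  show "split_endo ` jacobson_radical X.E \<subseteq> jacobson_radical Y.E"
    using split_endo_radical by blast
  have "X.endo (merge_coef \<psi>) \<in> jacobson_radical X.E" for \<psi>
    using merge_coef_closed[of \<psi>] X.endo_closed X.coef_endo by (simp add: X.jacobson_radical_iff)
  then show "(\<lambda>g. X.endo (merge_coef (Y.coef g))) ` jacobson_radical Y.E \<subseteq> jacobson_radical X.E"
    by blast
qed

text \<open>In a nonzero term the middle summand \<open>t\<close> is the start of a nonconstant
  path, hence lies neither at the sink nor at one of its halves. On the remaining summands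
  \<open>orig\<close> is a bijection, and the terms agree.\<close>

lemma split_coef_mult:
  assumes \<phi>: "\<phi> \<in> rad_coeffs_X" and \<chi>: "\<chi> \<in> rad_coeffs_X" and ok: "split_index s u r"
  shows "(\<Sum>t\<in>Y.summands. \<Sum>k\<le>length r. split_coef \<chi> s t (drop k r) * split_coef \<phi> t u (take k r)) =
    (\<Sum>t\<in>X.summands. \<Sum>k\<le>length r. \<chi> (orig s) t (drop k r) * \<phi> t (orig u) (take k r))"
    (is "(\<Sum>t\<in>Y.summands. ?G t) = (\<Sum>t\<in>X.summands. ?F t)")
proof -
  have nz: "p \<noteq> [] \<and> a \<in> X.summands \<and> b \<in> X.summands \<and> X.awalk (fst b) p (fst a)"
    if "\<theta> \<in> rad_coeffs_X" "\<theta> a b p \<noteq> 0" for \<theta> a b p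
    using that X.coeffsD[of \<theta> a b p] by blast
  have G0: "?G t = 0" if "\<not> (\<exists>i. fst t = Old i \<and> i \<noteq> v)" for t
  proof -
    have "\<not> split_index s t p" for p
    proof
      assume *: "split_index s t p"
      then obtain i where "fst t = Old i" by (auto simp: split_index_iff)
      moreover from * have "fst (orig t) \<noteq> v"
        using path_source_not_sink unfolding split_index_iff by blast
      ultimately show False using that by (simp add: orig_def)
    qed
    then show ?thesis by (simp add: split_coef_def)
  qed
  have F0: "?F t = 0" if "fst t = v" for t
  proof -
    have "\<chi> (orig s) t p = 0" for p
      using nz[OF \<chi>, of "orig s" t p] path_source_not_sink[of v p] that by metis
    then show ?thesis by simp
  qed
  have "(\<Sum>t\<in>Y.summands. ?G t) = (\<Sum>t\<in>{t \<in> Y.summands. \<exists>i. fst t = Old i \<and> i \<noteq> v}. ?G t)"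
    by (rule sum.mono_neutral_right) (use Y.finite_summands G0 in auto)
  also have "\<dots> = (\<Sum>t\<in>{t \<in> X.summands. fst t \<noteq> v}. ?F t)"
  proof (rule sum.reindex_bij_witness[where i = "\<lambda>t. (Old (fst t), snd t)" and j = orig])
    fix t assume "t \<in> {t \<in> Y.summands. \<exists>i. fst t = Old i \<and> i \<noteq> v}"
    then obtain i where i: "fst t = Old i" "i \<noteq> v" and tS: "t \<in> Y.summands" by blast
    have t: "fst (orig t) = i" "snd (orig t) = snd t"
      using i by (simp_all add: orig_def)
    show "(Old (fst (orig t)), snd (orig t)) = t"
      using t i by (simp add: prod_eq_iff)
    show "orig t \<in> {t \<in> X.summands. fst t \<noteq> v}" using t i orig_summands[OF tS] by auto
    show "?F (orig t) = ?G t"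
    proof (rule sum.cong[OF refl])
      fix k
      let ?c = "\<chi> (orig s) (orig t) (drop k r)" and ?f = "\<phi> (orig t) (orig u) (take k r)"
      \<comment> \<open>The two products could differ only where both factors over \<open>Q\<close>
        are nonzero; there both pieces of the cut path are shown to lift to
        \<open>Q'\<close>.\<close>
      have "split_index s t (drop k r)" "split_index t u (take k r)" if "?c \<noteq> 0" "?f \<noteq> 0"
      proof -
        note c = nz[OF \<chi> that(1)] and f = nz[OF \<phi> that(2)]
        have s: "s \<in> Y.summands" "u \<in> Y.summands" "fst s = head Q' (last r)" "fst u \<in> range Old"
          using ok by (simp_all add: split_index_iff)
        show "split_index s t (drop k r)"
          using c s i tS unfolding split_index_iff by (auto simp: last_drop)
        \<comment> \<open>The prefix ends at the vertex of \<open>orig t\<close>, which is not the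
          sink, so its last arrow has the same \<open>Old\<close> head in \<open>Q'\<close>.\<close>
        have "head Q' (last (take k r)) = fst t"
        proof -
          obtain q e where q: "take k r = q @ [e]"
            using f by (cases "take k r" rule: rev_cases) auto
          then have "e \<in> arcs Q" "head Q e = fst (orig t)"
            using f by (auto simp: X.awalk_Cons_iff X.awalk_Nil_iff)
          then show ?thesis using head_split[of e] t i q by simp
        qed
        then show "split_index t u (take k r)"
          using f s tS unfolding split_index_iff by auto
      qed
      then show "?c * ?f = split_coef \<chi> s t (drop k r) * split_coef \<phi> t u (take k r)"
        by (auto simp: split_coef_def)
    qed
  next
    fix t assume t: "t \<in> {t \<in> X.summands. fst t \<noteq> v}"
    then show "orig (Old (fst t), snd t) = t" by (simp add: orig_def)
    show "(Old (fst t), snd t) \<in> {t \<in> Y.summands. \<exists>i. fst t = Old i \<and> i \<noteq> v}"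
      using t Old_summands by simp
  qed
  also have "\<dots> = (\<Sum>t\<in>X.summands. ?F t)"
    by (rule sum.mono_neutral_left) (use X.finite_summands F0 in auto)
  finally show ?thesis .
qed

lemma split_endo_mult:
  assumes f: "f \<in> jacobson_radical X.E" and g: "g \<in> jacobson_radical X.E"
  shows "split_endo (f \<otimes>\<^bsub>X.E\<^esub> g) = split_endo f \<otimes>\<^bsub>Y.E\<^esub> split_endo g"
proof (rule split_endo_eqI)
  have c: "split_endo h \<in> carrier Y.E" for h
    using split_endo_radical[of h] by (simp add: Y.jacobson_radical_iff)
  show rad: "split_endo f \<otimes>\<^bsub>Y.E\<^esub> split_endo g \<in> jacobson_radical Y.E"
    by (rule ideal.I_l_closed[OF Y.ideal_jacobson_radical split_endo_radical c])
  have fc: "f \<in> carrier X.E" "X.coef f \<in> rad_coeffs_X"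
    and gc: "g \<in> carrier X.E" "X.coef g \<in> rad_coeffs_X"
    using f g X.coef_closed by (auto simp: X.jacobson_radical_iff)
  fix s u r
  show "split_coef (X.coef (f \<otimes>\<^bsub>X.E\<^esub> g)) s u r =
    Y.coef (split_endo f \<otimes>\<^bsub>Y.E\<^esub> split_endo g) s u r"
  proof (cases "split_index s u r")
    case True
    have "split_coef (X.coef (f \<otimes>\<^bsub>X.E\<^esub> g)) s u r = X.coef (f \<otimes>\<^bsub>X.E\<^esub> g) (orig s) (orig u) r"
      using True by (simp add: split_coef_def)
    also have "\<dots> = Y.coef (split_endo f \<otimes>\<^bsub>Y.E\<^esub> split_endo g) s u r"
      unfolding X.coef_mult[OF fc(1) gc(1)] Y.coef_mult[OF c c] coef_split_endo
      by (rule split_coef_mult[OF fc(2) gc(2) True, symmetric])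
    finally show ?thesis .
  next
    case False
    \<comment> \<open>Outside \<open>split_index\<close> the left side is 0 by definition. The
      product on the right is in the radical, so its nonzero coefficients sit on nonconstant walks
      of \<open>Q'\<close>.\<close>
    moreover have "split_endo f \<otimes>\<^bsub>Y.E\<^esub> split_endo g \<in> carrier Y.E"
        "\<And>s u. Y.coef (split_endo f \<otimes>\<^bsub>Y.E\<^esub> split_endo g) s u [] = 0"
      using rad by (auto simp: Y.jacobson_radical_iff)
    ultimately have "Y.coef (split_endo f \<otimes>\<^bsub>Y.E\<^esub> split_endo g) s u r = 0"
      using Y.coeffsD[OF Y.coef_closed] unfolding split_index_def by metis
    then show ?thesis using False by (simp add: split_coef_def)
  qed
qed

text \<open>Linearity holds because \<open>coef\<close> and \<open>split_coef\<close> respect sums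
  and scalars entry by entry; bijectivity and multiplicativity are \<open>bij_split_endo\<close> and
  \<open>split_endo_mult\<close>.\<close>

lemma ideals_isomorphic_split:
  "ideals_isomorphic X.E (jacobson_radical X.E) Y.E (jacobson_radical Y.E)"
  unfolding ideals_isomorphic_def
proof (intro conjI exI[of _ split_endo] ballI allI)
  have c: "split_endo h \<in> carrier Y.E" "Y.coef (split_endo h) s t [] = 0" for h s t
    using split_endo_radical[of h] unfolding Y.jacobson_radical_iff by blast+
  show "split_endo (f \<oplus>\<^bsub>X.E\<^esub> g) = split_endo f \<oplus>\<^bsub>Y.E\<^esub> split_endo g" for f g
  proof (rule split_endo_eqI)
    show "split_endo f \<oplus>\<^bsub>Y.E\<^esub> split_endo g \<in> jacobson_radical Y.E"
      by (simp add: Y.jacobson_radical_iff Y.End_closed Y.coef_add c)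
  qed (simp add: Y.coef_add X.coef_add coef_split_endo split_coef_def)
  show "split_endo (a \<odot>\<^bsub>X.E\<^esub> f) = a \<odot>\<^bsub>Y.E\<^esub> split_endo f" for a f
  proof (rule split_endo_eqI)
    show "a \<odot>\<^bsub>Y.E\<^esub> split_endo f \<in> jacobson_radical Y.E"
      by (simp add: Y.jacobson_radical_iff Y.End_closed(3)[OF c(1) c(1)] Y.coef_smult c)
  qed (simp add: Y.coef_smult X.coef_smult coef_split_endo split_coef_def)
qed (simp_all add: X.ideal_jacobson_radical Y.ideal_jacobson_radical bij_split_endo split_endo_mult)

end

theorem corollary3p19:
  fixes Q :: "('v, 'e) pre_digraph" and v :: 'v and d :: "'v \<Rightarrow> nat" and \<A> \<B> :: "'e set"
  assumes "fin_digraph Q"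
    and "\<nexists>p. pre_digraph.cycle Q p"
    and "v \<in> verts Q" and "out_arcs Q v = {}"
    and "\<A> \<union> \<B> = in_arcs Q v" and "\<A> \<inter> \<B> = {}"
  defines "Q' \<equiv> split_quiver Q v \<A> \<B>" and "d' \<equiv> split_dim d v"
  shows "ideals_isomorphic
           (A_algebra Q d :: ('k::{field, finite}, _) module) (jacobson_radical (A_algebra Q d))
           (A_algebra Q' d') (jacobson_radical (A_algebra Q' d'))
       \<and> commuting_count TYPE('k) Q d = commuting_count TYPE('k) Q' d'"
proof -
  interpret fin_digraph Q by fact
  \<comment> \<open>Acyclicity enters here, through the finiteness of the set of walks.\<close>
  interpret split_sink Q d "TYPE('k)" v \<A> \<B>
    by unfold_locales (use assms finite_walks_if_acyclic in auto)
  show ?thesis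
    unfolding Q'_def d'_def commuting_count_def Let_def
    using ideals_isomorphic_split ideals_isomorphic_commuting_pairs[OF ideals_isomorphic_split]
    by blast
qed

end
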